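(* Let $L>0$ and $\Delta t>0$, and let $X_{1,\mathrm{d}}\subset X_1$ and $X_{2,\mathrm{d}}\subset X_2$ be finite-dimensional linear subspaces. Let $u^{(n)}\in X_{1,\mathrm{d}}$, and suppose that $u^{(n+1)}\in X_{1,\mathrm{d}}$ and $q^{(n+\frac12)}\in X_{2,\mathrm{d}}$ satisfy, for all $v_1\in X_{1,\mathrm{d}}$ and $v_2\in X_{2,\mathrm{d}}$, $$\left(\frac{u_x^{(n+1)}-u_x^{(n)}}{\Delta t},(v_1)_x\right)=\left(q^{(n+\frac12)}u_x^{(n+\frac12)}+\left(q^{(n+\frac12)}u^{(n+\frac12)}\right)_x,\,v_1\right),$$ $$\left(q^{(n+\frac12)},v_2\right)=-\left(u_x^{(n+\frac12)},(v_2)_x\right),$$ where $u^{(n+\frac12)}=\frac12\left(u^{(n)}+u^{(n+1)}\right)$. Then $$\int_{-L}^{L}\frac12\left(u_x^{(n+1)}\right)^2\mathrm{d}x=\int_{-L}^{L}\frac12\left(u_x^{(n)}\right)^2\mathrm{d}x .$$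
   Context: All functions are real-valued. $H^1(-L,L)$ is the usual first-order Sobolev space on $(-L,L)$ and $$X_1=\{v\in H^1(-L,L)\mid v(-L)=0\},\qquad X_2=\{v\in H^1(-L,L)\mid v(L)=0\}.$$ The bracket is $(f,g)=\int_{-L}^{L} f g\,\mathrm{d}x$, and the subscript $x$ denotes the (weak) derivative in $x$. The relations in the claim are one time step (from step $n$ to step $n+1$, $n=0,1,2,\dots$, starting from a given $u^{(0)}\in X_{1,\mathrm{d}}$) of a fully discrete Galerkin scheme for the Hunter--Saxton equation, where $u^{(n)}(\cdot)\approx u(\cdot,n\Delta t)$ and $q^{(n+\frac12)}$ is an intermediate variable. *)

theory Defs
  imports "HOL-Analysis.Analysis" "HOL-Library.Function_Algebras"
begin

instantiation "fun" :: (type, real_vector) real_vector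
begin

definition scaleR_fun :: "real \<Rightarrow> ('a \<Rightarrow> 'b) \<Rightarrow> 'a \<Rightarrow> 'b"
  where "scaleR_fun c f = (\<lambda>x. c *\<^sub>R f x)"

instance
  by standard (simp_all add: scaleR_fun_def fun_eq_iff scaleR_add_right scaleR_add_left)

end

definition test_functions :: "real \<Rightarrow> (real \<Rightarrow> real) set" where
  "test_functions L =
     {\<phi>. (\<forall>k x. (deriv ^^ k) \<phi> field_differentiable (at x)) \<and>
         (\<exists>K. compact K \<and> K \<subseteq> {-L<..<L} \<and> (\<forall>x. x \<notin> K \<longrightarrow> \<phi> x = 0))}"

definition locally_integrable :: "real \<Rightarrow> (real \<Rightarrow> real) \<Rightarrow> bool" where
  "locally_integrable L f \<longleftrightarrow>
     (\<forall>K. compact K \<and> K \<subseteq> {-L<..<L} \<longrightarrow> set_integrable lborel K f)"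

definition has_weak_deriv :: "real \<Rightarrow> (real \<Rightarrow> real) \<Rightarrow> (real \<Rightarrow> real) \<Rightarrow> bool" where
  "has_weak_deriv L u g \<longleftrightarrow>
     locally_integrable L u \<and> locally_integrable L g \<and>
     (\<forall>\<phi>\<in>test_functions L.
        (LINT x:{-L<..<L}|lborel. u x * deriv \<phi> x) = - (LINT x:{-L<..<L}|lborel. g x * \<phi> x))"

text \<open>A weak derivative is unique up to null sets of \<open>(-L, L)\<close>, so this choice does not affect
  integrals over that interval.\<close>

definition weak_deriv :: "real \<Rightarrow> (real \<Rightarrow> real) \<Rightarrow> real \<Rightarrow> real" where
  "weak_deriv L u = (SOME g. has_weak_deriv L u g)"

definition square_integrable :: "real \<Rightarrow> (real \<Rightarrow> real) \<Rightarrow> bool" where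
  "square_integrable L f \<longleftrightarrow>
     set_borel_measurable lborel {-L<..<L} f \<and>
     set_integrable lborel {-L<..<L} (\<lambda>x. (f x)\<^sup>2)"

text \<open>Each class in \<open>H\<^sup>1(-L, L)\<close> has exactly one representative that is continuous on \<open>[-L, L]\<close>
  (its endpoint values are the traces) and \<open>0\<close> elsewhere. The space is formed of these
  representatives, so equality of functions is equality in \<open>H\<^sup>1\<close>, and the pointwise operations are
  those of \<open>H\<^sup>1\<close>.\<close>

definition H1 :: "real \<Rightarrow> (real \<Rightarrow> real) set" where
  "H1 L =
     {u. continuous_on {-L..L} u \<and> (\<forall>x. x \<notin> {-L..L} \<longrightarrow> u x = 0) \<and>
         square_integrable L u \<and>
         (\<exists>g. has_weak_deriv L u g \<and> square_integrable L g)}"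

definition X1 :: "real \<Rightarrow> (real \<Rightarrow> real) set" where
  "X1 L = {v \<in> H1 L. v (-L) = 0}"

definition X2 :: "real \<Rightarrow> (real \<Rightarrow> real) set" where
  "X2 L = {v \<in> H1 L. v L = 0}"

definition finite_dimensional_subspace :: "'a::real_vector set \<Rightarrow> bool" where
  "finite_dimensional_subspace V \<longleftrightarrow> subspace V \<and> (\<exists>B. finite B \<and> span B = V)"

definition bracket :: "real \<Rightarrow> (real \<Rightarrow> real) \<Rightarrow> (real \<Rightarrow> real) \<Rightarrow> real" where
  "bracket L f g = (LINT x:{-L<..<L}|lborel. f x * g x)"

end

theory Submission
  imports Defs
begin

text \<open>Write \<open>u\<close> and \<open>q\<close> for the half-step functions and \<open>w = q u\<close>. The function \<open>u\<close> lies in the trial space, so it may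
be taken as test function in the first relation. Since \<open>u\<^sub>x\<close> is the mean of the old and the new
derivative, the left-hand side becomes the difference of the two squared norms divided by
\<open>2 \<Delta>t\<close>, and the right-hand side becomes the integral of \<open>w u\<^sub>x + w\<^sub>x u = (w u)\<^sub>x\<close>. That integral is a
difference of boundary values of \<open>q u\<^sup>2\<close>, which vanish: \<open>u (-L) = 0\<close> and \<open>q L = 0\<close>.

What has to be justified is the calculus of weak derivatives. The weak derivative is an arbitrary
choice among all functions that satisfy the integration by parts formula against test functions, so
both \<open>(q u)\<^sub>x = q u\<^sub>x + q\<^sub>x u\<close> and linearity hold only almost everywhere, and they rest on uniqueness of
weak derivatives. The link to classical calculus is the predicate \<open>has_L1_deriv\<close>, which says that a
function is a primitive of an integrable function, i.e. absolutely continuous.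

\<^item> A continuous function with weak derivative \<open>g\<close> is a primitive of \<open>g\<close>
  (\<open>weak_deriv_Ioc_integral\<close>). This follows by testing with smooth plateau functions that tend to the
  indicator function of an interval; it needs one smooth step function
  (\<open>smooth_step_exists\<close>), built from \<open>exp (-1 / (x (1 - x)))\<close>.

\<^item> Two weak derivatives of one function then have equal integrals over all intervals, so they agree
  almost everywhere (\<open>weak_deriv_unique\<close>).

\<^item> Primitives obey the product rule, by Fubini's theorem
  (\<open>integral_mult_primitive\<close>, \<open>has_L1_deriv_mult\<close>). Applied to a primitive and a test function, this
  shows conversely that primitives have weak derivatives
  (\<open>has_L1_deriv_imp_has_weak_deriv\<close>). Hence the product \<open>q u\<close> has a weak derivative at all, and the
  product rule for it.\<close>

section \<open>A smooth step function\<close>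

lemma DERIV_zero_if_quadratic:
  fixes f :: "real \<Rightarrow> real"
  assumes "\<And>y. \<bar>f y - f x\<bar> \<le> C * (y - x)\<^sup>2"
  shows "(f has_real_derivative 0) (at x)"
  unfolding has_field_derivative_iff
proof (rule Lim_null_comparison)
  show "\<forall>\<^sub>F y in at x. norm ((f y - f x) / (y - x)) \<le> C * \<bar>y - x\<bar>"
  proof (rule always_eventually, rule allI)
    fix y
    show "norm ((f y - f x) / (y - x)) \<le> C * \<bar>y - x\<bar>"
    proof (cases "y = x")
      case False
      have "C * (y - x)\<^sup>2 = C * \<bar>y - x\<bar> * \<bar>y - x\<bar>"
        by (simp add: power2_eq_square abs_mult_self_eq)
      with assms[of y] False show ?thesis
        by (simp add: divide_le_eq)
    qed simp
  qed
  show "((\<lambda>y. C * \<bar>y - x\<bar>) \<longlongrightarrow> 0) (at x)"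
    by (auto intro!: tendsto_eq_intros)
qed

lemma power_div_fact_le_exp:
  fixes x :: real
  assumes "x \<ge> 0"
  shows "x ^ m / fact m \<le> exp x"
proof -
  have "(\<lambda>n. x ^ n / fact n) sums exp x"
    using exp_converges[of x] by (simp add: divide_inverse mult.commute)
  then show ?thesis
    using sum_le_suminf[of "\<lambda>n. x ^ n / fact n" "{m}"] assms by (simp add: sums_iff)
qed

text \<open>The derivatives of the standard bump function \<open>exp (-1 / (x (1 - x)))\<close> on \<open>(0, 1)\<close> all have the form
\<open>p(x) / (x (1 - x))\<^sup>k\<close> times the bump function, with a polynomial \<open>p\<close>. Treating all functions of this
form at once makes the family closed under differentiation, so smoothness needs only one
differentiation.\<close>

definition bump :: "real poly \<Rightarrow> nat \<Rightarrow> real \<Rightarrow> real" where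
  "bump p k x =
     (if 0 < x \<and> x < 1 then poly p x / (x * (1 - x)) ^ k * exp (- 1 / (x * (1 - x))) else 0)"

text \<open>The exponential decays faster than any power of \<open>t = x (1 - x)\<close>: by \<open>(1 / t)\<^sup>m / m! \<le> exp (1 / t)\<close> with
\<open>m = k + 2\<close>, two factors of \<open>t\<close> remain after the denominator \<open>t\<^sup>k\<close> is absorbed. A quadratic bound
is what makes the extension by zero differentiable at the endpoints.\<close>

lemma bump_quadratic_bound:
  obtains C where "C \<ge> 0" "\<And>x. 0 < x \<Longrightarrow> x < 1 \<Longrightarrow> \<bar>bump p k x\<bar> \<le> C * (x * (1 - x))\<^sup>2"
proof -
  have "bounded (poly p ` {0..1})"
    by (intro compact_imp_bounded compact_continuous_image continuous_intros) auto
  then obtain B where B: "B > 0" "\<And>x. x \<in> {0..1} \<Longrightarrow> \<bar>poly p x\<bar> \<le> B"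
    unfolding bounded_pos by auto
  have "\<bar>bump p k x\<bar> \<le> (B * fact (k + 2)) * (x * (1 - x))\<^sup>2" if x: "0 < x" "x < 1" for x
  proof -
    define t where "t = x * (1 - x)"
    have t: "t > 0" using x by (simp add: t_def)
    have "(1 / t) ^ (k + 2) / fact (k + 2) \<le> exp (1 / t)"
      using t by (intro power_div_fact_le_exp) auto
    then have "exp (- 1 / t) \<le> fact (k + 2) * (t ^ k * t\<^sup>2)"
      using t by (simp add: field_simps exp_minus power_divide power_add power2_eq_square
          del: fact_Suc)
    then have "exp (- 1 / t) / t ^ k \<le> fact (k + 2) * t\<^sup>2"
      using t by (simp add: divide_le_eq mult_ac del: fact_Suc)
    then have "\<bar>poly p x\<bar> * (exp (- 1 / t) / t ^ k) \<le> B * (fact (k + 2) * t\<^sup>2)"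
      using B x t by (intro mult_mono) auto
    then show ?thesis
      using x t by (simp add: bump_def abs_mult flip: t_def) 
  qed
  with B(1) show thesis by (intro that[of "B * fact (k + 2)"]) auto
qed

lemma DERIV_divide_power_mult_exp:
  fixes f t :: "real \<Rightarrow> real"
  assumes "(f has_real_derivative f') (at x)" "(t has_real_derivative t') (at x)" "t x > 0"
  shows "((\<lambda>x. f x / t x ^ k * exp (- 1 / t x)) has_real_derivative
    (f' * (t x)\<^sup>2 - real k * (f x * t' * t x) + f x * t') / t x ^ (k + 2) * exp (- 1 / t x)) (at x)"
proof (cases k)
  case 0
  show ?thesis unfolding 0
    by (rule derivative_eq_intros assms refl | use assms in \<open>simp add: field_simps power2_eq_square\<close>)+
next
  case (Suc m)
  show ?thesis unfolding Suc
    by (rule derivative_eq_intros assms refl | use assms in \<open>simp add: field_simps power2_eq_square\<close>)+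
qed

lemma bump_DERIV:
  "(bump p k has_real_derivative
     bump (pderiv p * [:0, 1, -1:]\<^sup>2 - smult (real k) (p * [:1, -2:] * [:0, 1, -1:]) + p * [:1, -2:])
       (k + 2) x) (at x)"
proof (cases "0 < x \<and> x < 1")
  case True
  have eq: "bump p k y = poly p y / poly [:0, 1, -1:] y ^ k * exp (- 1 / poly [:0, 1, -1:] y)"
    if "0 < y" "y < 1" for p k y
    using that by (simp add: bump_def algebra_simps)
  have pos: "poly [:0, 1, -1:] x > 0" using True by (simp add: algebra_simps)
  have t': "pderiv [:0, 1, -1::real:] = [:1, -2:]" by (simp add: pderiv_pCons)
  have "((\<lambda>x. poly p x / poly [:0, 1, -1:] x ^ k * exp (- 1 / poly [:0, 1, -1:] x))
       has_real_derivative bump (pderiv p * [:0, 1, -1:]\<^sup>2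
         - smult (real k) (p * [:1, -2:] * [:0, 1, -1:]) + p * [:1, -2:]) (k + 2) x) (at x)"
    unfolding eq[OF True[THEN conjunct1] True[THEN conjunct2]] poly_add poly_diff poly_mult
      poly_power poly_smult
    using DERIV_divide_power_mult_exp[OF poly_DERIV poly_DERIV pos, of p k, unfolded t'] .
  then show ?thesis
  proof (rule has_field_derivative_transform_within_open)
    show "open {0<..<1::real}" by simp
  qed (use True in \<open>auto simp: bump_def\<close>)
next
  case False
  obtain C where C: "C \<ge> 0" "\<And>x. 0 < x \<Longrightarrow> x < 1 \<Longrightarrow> \<bar>bump p k x\<bar> \<le> C * (x * (1 - x))\<^sup>2"
    using bump_quadratic_bound by metis
  have "\<bar>bump p k y - bump p k x\<bar> \<le> C * (y - x)\<^sup>2" for y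
  proof (cases "0 < y \<and> y < 1")
    case True
    have "y * (1 - y) \<le> \<bar>y - x\<bar>"
    proof (cases "x \<le> 0")
      case True
      have "y * (1 - y) \<le> y" using \<open>0 < y \<and> y < 1\<close> by (intro mult_left_le) auto
      with True show ?thesis by linarith
    next
      case x: False
      have "y * (1 - y) \<le> 1 - y" using True by (intro mult_left_le_one_le) auto
      with x False show ?thesis by linarith
    qed
    then have "(y * (1 - y))\<^sup>2 \<le> (y - x)\<^sup>2"
      using True power_mono[of "y * (1 - y)" "\<bar>y - x\<bar>" 2] by simp
    then have "C * (y * (1 - y))\<^sup>2 \<le> C * (y - x)\<^sup>2"
      using C(1) by (rule mult_left_mono)
    with C(2)[of y] True False show ?thesis by (auto simp: bump_def)
  qed (use False C(1) in \<open>auto simp: bump_def\<close>)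
  then have "(bump p k has_real_derivative 0) (at x)"
    by (rule DERIV_zero_if_quadratic)
  moreover have "bump r m x = 0" for r m
    using False by (auto simp: bump_def)
  ultimately show ?thesis by simp
qed

definition smooth :: "(real \<Rightarrow> real) \<Rightarrow> bool" where
  "smooth f \<longleftrightarrow> (\<forall>k x. (deriv ^^ k) f field_differentiable (at x))"

lemma smooth_DERIV: "smooth f \<Longrightarrow> (f has_real_derivative deriv f x) (at x)"
  unfolding smooth_def
  by (metis DERIV_deriv_iff_field_differentiable funpow_0)

text \<open>Smoothness by coinduction: it suffices to exhibit a family of functions that contains \<open>f\<close> and is
closed under differentiation.\<close>

lemma smooth_if_family:
  assumes "f \<in> C"
    and "\<And>g. g \<in> C \<Longrightarrow> \<exists>g'\<in>C. \<forall>x. (g has_real_derivative g' x) (at x)"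
  shows "smooth f"
proof -
  have *: "deriv g \<in> C \<and> g field_differentiable (at x)" if g: "g \<in> C" for g x
  proof -
    obtain g' where g': "g' \<in> C" "\<And>x. (g has_real_derivative g' x) (at x)"
      using assms(2)[OF g] by blast
    have "deriv g = g'" using g'(2) DERIV_imp_deriv by blast
    with g' show ?thesis by (auto simp: field_differentiable_def)
  qed
  have "(deriv ^^ k) f \<in> C" for k
    by (induction k) (use * assms(1) in auto)
  with * show ?thesis by (auto simp: smooth_def)
qed

lemma smooth_bump: "smooth (bump p k)"
  by (rule smooth_if_family[where C = "{bump p k | p k. True}"]) (use bump_DERIV in blast)+

lemma smooth_diff_affine:
  assumes "smooth f"
  shows "smooth (\<lambda>x. f (m * x + c) - f (m * x + d))"
proof (rule smooth_if_family[where
      C = "{\<lambda>x. r * ((deriv ^^ k) f (m * x + c) - (deriv ^^ k) f (m * x + d)) | r k. True}"])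
  show "(\<lambda>x. f (m * x + c) - f (m * x + d))
    \<in> {\<lambda>x. r * ((deriv ^^ k) f (m * x + c) - (deriv ^^ k) f (m * x + d)) | r k. True}"
    by (rule CollectI, rule exI[of _ 1], rule exI[of _ 0]) simp
next
  fix g
  assume "g \<in> {\<lambda>x. r * ((deriv ^^ k) f (m * x + c) - (deriv ^^ k) f (m * x + d)) | r k. True}"
  then obtain r k
    where g: "g = (\<lambda>x. r * ((deriv ^^ k) f (m * x + c) - (deriv ^^ k) f (m * x + d)))" by auto
  have D: "((deriv ^^ k) f has_real_derivative (deriv ^^ Suc k) f x) (at x)" for x
    using assms by (simp add: smooth_def DERIV_deriv_iff_field_differentiable)
  have "(g has_real_derivative
      (r * m) * ((deriv ^^ Suc k) f (m * x + c) - (deriv ^^ Suc k) f (m * x + d))) (at x)" for x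
    unfolding g by (rule derivative_eq_intros DERIV_chain2[OF D] refl | simp add: algebra_simps)+
  then show "\<exists>g'\<in>{\<lambda>x. r * ((deriv ^^ k) f (m * x + c) - (deriv ^^ k) f (m * x + d)) | r k. True}.
      \<forall>x. (g has_real_derivative g' x) (at x)"
    by (intro bexI[of _ "\<lambda>x. (r * m) * ((deriv ^^ Suc k) f (m * x + c) - (deriv ^^ Suc k) f (m * x + d))"])
      blast+
qed

lemma smooth_deriv: "smooth f \<Longrightarrow> smooth (deriv f)"
  unfolding smooth_def by (metis comp_apply funpow_Suc_right)

lemma smooth_isCont: "smooth f \<Longrightarrow> isCont f x"
  using DERIV_isCont smooth_DERIV by blast

text \<open>A smooth transition from \<open>0\<close> to \<open>1\<close>. Differences of its rescaled translates approximate indicator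
functions of intervals, and its derivative is a mollifier.\<close>

locale smooth_step =
  fixes \<sigma> :: "real \<Rightarrow> real"
  assumes smooth: "smooth \<sigma>"
    and eq_0: "x \<le> 0 \<Longrightarrow> \<sigma> x = 0"
    and eq_1: "x \<ge> 1 \<Longrightarrow> \<sigma> x = 1"
    and nonneg: "0 \<le> \<sigma> x"
    and le_1: "\<sigma> x \<le> 1"

lemma smooth_step_exists:
  obtains \<sigma> :: "real \<Rightarrow> real"
  where "smooth_step \<sigma>"
proof -
  define \<rho> where "\<rho> = bump 1 0"
  have nonneg: "\<rho> x \<ge> 0" for x by (simp add: \<rho>_def bump_def)
  have cont: "continuous_on A \<rho>" for A
    unfolding \<rho>_def using smooth_bump by (meson DERIV_continuous_on has_field_derivative_at_within smooth_DERIV)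
  define S where "S x = integral {-1..x} \<rho>" for x
  have S0: "S x = 0" if "x \<le> 0" for x
  proof -
    have "S x = integral {-1..x} (\<lambda>_. 0)"
      unfolding S_def using that by (intro integral_cong) (auto simp: \<rho>_def bump_def)
    then show ?thesis by simp
  qed
  have D: "(S has_real_derivative \<rho> x) (at x)" for x
  proof (cases "x < 0")
    case True
    have "((\<lambda>_. 0) has_real_derivative 0) (at x)" by simp
    then have "(S has_real_derivative 0) (at x)"
      by (rule has_field_derivative_transform_within_open[where S = "{..<0}"]) (use True S0 in auto)
    then show ?thesis using True by (simp add: \<rho>_def bump_def)
  next
    case False
    then have "(S has_real_derivative \<rho> x) (at x within {-1..x+1})"
      unfolding S_def by (intro integral_has_real_derivative cont) auto
    then show ?thesis
      using False at_within_interior[of x "{-1..x+1}"] by (simp add: interior_atLeastAtMost_real)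
  qed
  have "S 0 < S 1"
    by (rule DERIV_pos_imp_increasing_open)
      (use D DERIV_isCont in \<open>force simp: \<rho>_def bump_def intro!: continuous_at_imp_continuous_on\<close>)+
  then have pos: "S 1 > 0" using S0 by simp
  have mono: "S x \<le> S y" if "x \<le> y" for x y
    using that by (rule DERIV_nonneg_imp_nondecreasing) (use D nonneg in blast)
  have S1: "S x = S 1" if "x \<ge> 1" for x
  proof (cases "x = 1")
    case False
    have "(S has_real_derivative 0) (at y)" if "y > 1" for y
      using D[of y] that by (simp add: \<rho>_def bump_def)
    moreover have "continuous_on {1..x} S"
      using D by (meson DERIV_continuous_on has_field_derivative_at_within)
    ultimately show ?thesis
      using DERIV_isconst_end[of 1 x S] False that by auto
  qed simp
  define \<sigma> where "\<sigma> x = S x / S 1" for x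
  have "smooth_step \<sigma>"
  proof
    show "smooth \<sigma>"
    proof (rule smooth_if_family[where C = "insert \<sigma> {bump p k | p k. True}"])
      fix g assume "g \<in> insert \<sigma> {bump p k | p k. True}"
      then consider "g = \<sigma>" | p k where "g = bump p k" by auto
      then show "\<exists>g'\<in>insert \<sigma> {bump p k | p k. True}. \<forall>x. (g has_real_derivative g' x) (at x)"
      proof cases
        case 1
        have "(\<sigma> has_real_derivative bump [:1 / S 1:] 0 x) (at x)" for x
        proof -
          have "(\<sigma> has_real_derivative \<rho> x / S 1) (at x)"
            unfolding \<sigma>_def by (intro DERIV_cdivide D)
          also have "\<rho> x / S 1 = bump [:1 / S 1:] 0 x" by (simp add: \<rho>_def bump_def)
          finally show ?thesis .
        qed
        with 1 show ?thesis by blast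
      qed (use bump_DERIV in blast)
    qed simp
  next
    fix x
    show "\<sigma> x = 0" if "x \<le> 0"
      using S0[OF that] by (simp add: \<sigma>_def)
    have one: "\<sigma> x = 1" if "x \<ge> 1"
      using S1[OF that] pos by (simp add: \<sigma>_def)
    show "\<sigma> x = 1" if "x \<ge> 1" using one[OF that] .
    show "0 \<le> \<sigma> x"
      using mono[of 0 x] S0[of x] S0[of 0] pos by (cases "x \<le> 0") (auto simp: \<sigma>_def)
    show "\<sigma> x \<le> 1"
      using mono[of x 1] one pos by (cases "x \<ge> 1") (auto simp: \<sigma>_def)
  qed
  then show thesis by (rule that)
qed

context smooth_step
begin

lemma deriv_eq_0:
  assumes "x \<notin> {0..1}"
  shows "deriv \<sigma> x = 0"
proof (rule DERIV_imp_deriv)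
  consider "x < 0" | "x > 1" using assms by force
  then show "(\<sigma> has_real_derivative 0) (at x)"
  proof cases
    case 1
    show ?thesis
      by (rule has_field_derivative_transform_within_open[of "\<lambda>_. 0" _ _ "{..<0}"])
        (use 1 eq_0 in auto)
  next
    case 2
    show ?thesis
      by (rule has_field_derivative_transform_within_open[of "\<lambda>_. 1" _ _ "{1<..}"])
        (use 2 eq_1 in auto)
  qed
qed

lemma deriv_integral: "has_bochner_integral lborel (deriv \<sigma>) 1"
proof -
  have "has_bochner_integral lborel (\<lambda>x. deriv \<sigma> x * indicator {0..1} x) (\<sigma> 1 - \<sigma> 0)"
    by (rule has_bochner_integral_FTC_Icc_real)
      (use smooth smooth_DERIV smooth_isCont smooth_deriv in auto)
  also have "(\<lambda>x. deriv \<sigma> x * indicator {0..1} x) = deriv \<sigma>"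
    using deriv_eq_0 by (auto simp: fun_eq_iff indicator_def)
  finally show ?thesis by (simp add: eq_0 eq_1)
qed

lemma borel_measurable_deriv [measurable]: "deriv \<sigma> \<in> borel_measurable borel"
  using deriv_integral by (auto simp: has_bochner_integral_iff dest: borel_measurable_integrable)

text \<open>Substituting \<open>x = a + y / (n + 1)\<close> turns the integral into that of \<open>v (a + y / (n + 1)) \<sigma>'(y)\<close>, to which dominated
convergence applies.\<close>

lemma approximate_identity:
  fixes v :: "real \<Rightarrow> real"
  assumes [measurable]: "v \<in> borel_measurable borel"
    and bound: "\<And>x. \<bar>v x\<bar> \<le> B"
    and cont: "isCont v a"
  shows "integrable lborel (\<lambda>x. v x * (real (Suc n) * deriv \<sigma> (real (Suc n) * (x - a))))" (is "integrable _ (?f n)")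
    and "(\<lambda>n. LINT x|lborel. v x * (real (Suc n) * deriv \<sigma> (real (Suc n) * (x - a)))) \<longlonglongrightarrow> v a"
proof -
  let ?g = "\<lambda>n y. v (a + y / real (Suc n)) * deriv \<sigma> y"
  have int: "integrable lborel (deriv \<sigma>)" and one: "(LINT x|lborel. deriv \<sigma> x) = 1"
    using deriv_integral by (auto simp: has_bochner_integral_iff)
  have dom: "integrable lborel (\<lambda>x. B * \<bar>deriv \<sigma> x\<bar>)"
    using int by auto
  have le: "norm (?g n y) \<le> B * \<bar>deriv \<sigma> y\<bar>" for n y
    using bound by (auto simp: abs_mult intro: mult_right_mono)
  have eq: "?f n (a + 1 / real (Suc n) * y) = real (Suc n) * ?g n y" for n y
  proof -
    have "real (Suc n) * (a + 1 / real (Suc n) * y - a) = y" by (simp del: of_nat_Suc)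
    then show ?thesis by (simp only:) (simp only: mult_ac times_divide_eq_right mult_1_right mult_1_left)
  qed
  have "integrable lborel (?g n)" for n
    by (rule Bochner_Integration.integrable_bound[OF dom]) (use le in \<open>auto intro!: AE_I2 order_trans[OF _ abs_ge_self] simp del: of_nat_Suc\<close>)
  then have "integrable lborel (\<lambda>y. ?f n (a + 1 / real (Suc n) * y))" for n
    unfolding eq by simp
  then show "integrable lborel (?f n)" for n
    by (rule lborel_integrable_real_affine_iff[THEN iffD1, rotated]) simp
  have "(LINT x|lborel. ?f n x) = (LINT y|lborel. ?g n y)" for n
    by (subst lborel_integral_real_affine[of "1 / real (Suc n)" _ a], simp, unfold eq) simp
  moreover have "(\<lambda>n. LINT y|lborel. ?g n y) \<longlonglongrightarrow> (LINT y|lborel. v a * deriv \<sigma> y)"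
  proof (rule integral_dominated_convergence[OF _ _ dom])
    show "AE y in lborel. (\<lambda>n. ?g n y) \<longlonglongrightarrow> v a * deriv \<sigma> y"
    proof (rule AE_I2)
      fix y
      have "(\<lambda>n. y * inverse (Suc n)) \<longlonglongrightarrow> y * 0"
        by (intro tendsto_intros LIMSEQ_inverse_real_of_nat)
      then have "(\<lambda>n. a + y / real (Suc n)) \<longlonglongrightarrow> a"
        using tendsto_add[OF tendsto_const[of a]] by (force simp: divide_inverse)
      then have "(\<lambda>n. v (a + y / real (Suc n))) \<longlonglongrightarrow> v a"
        by (rule isCont_tendsto_compose[OF cont])
      then show "(\<lambda>n. ?g n y) \<longlonglongrightarrow> v a * deriv \<sigma> y"
        by (intro tendsto_intros)
    qed
  qed (use le in auto)
  ultimately show "(\<lambda>n. LINT x|lborel. ?f n x) \<longlonglongrightarrow> v a"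
    by (simp add: one)
qed

definition plateau :: "real \<Rightarrow> real \<Rightarrow> nat \<Rightarrow> real \<Rightarrow> real" where
  "plateau a b n x = \<sigma> (real (Suc n) * (x - a)) - \<sigma> (real (Suc n) * (x - b))"

lemma plateau_tendsto:
  assumes "a \<le> b"
  shows "(\<lambda>n. plateau a b n x) \<longlonglongrightarrow> indicator {a<..b} x"
proof -
  have lim: "(\<lambda>n. \<sigma> (real (Suc n) * (x - c))) \<longlonglongrightarrow> indicator {c<..} x" for c
  proof (cases "x > c")
    case True
    obtain N :: nat where N: "1 / (x - c) \<le> N" using real_arch_simple by blast
    have "\<sigma> (real (Suc n) * (x - c)) = 1" if "n \<ge> N" for n
    proof (rule eq_1)
      have "1 / (x - c) \<le> real (Suc n)" using N that by linarith
      then show "1 \<le> real (Suc n) * (x - c)" using True by (simp add: divide_le_eq)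
    qed
    then have "\<forall>\<^sub>F n in sequentially. \<sigma> (real (Suc n) * (x - c)) = 1"
      by (auto simp: eventually_sequentially)
    then show ?thesis using True by (auto intro: tendsto_eventually)
  next
    case False
    then have "\<sigma> (real (Suc n) * (x - c)) = 0" for n
      by (intro eq_0 mult_nonneg_nonpos) auto
    with False show ?thesis by simp
  qed
  have "indicator {a<..b} x = indicator {a<..} x - (indicator {b<..} x :: real)"
    using assms by (auto simp: indicator_def)
  with tendsto_diff[OF lim lim] show ?thesis by (simp add: plateau_def)
qed

lemma plateau_bound: "\<bar>plateau a b n x\<bar> \<le> 1"
  using nonneg le_1 by (smt (verit) plateau_def)

lemma plateau_support:
  assumes "a \<le> b" "1 \<le> real (Suc n) * (d - b)" "x \<notin> {a..d}"
  shows "plateau a b n x = 0"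
proof -
  consider "x < a" | "x > d" using assms(3) by force
  then show ?thesis
  proof cases
    case 1
    then have "real (Suc n) * (x - a) \<le> 0" "real (Suc n) * (x - b) \<le> 0"
      using assms(1) by (auto intro!: mult_nonneg_nonpos)
    then show ?thesis by (simp add: plateau_def eq_0)
  next
    case 2
    then have "real (Suc n) * (d - b) \<le> real (Suc n) * (x - b)"
      by (intro mult_left_mono) auto
    moreover have "real (Suc n) * (x - b) \<le> real (Suc n) * (x - a)"
      using assms(1) by (intro mult_left_mono) auto
    ultimately have "1 \<le> real (Suc n) * (x - b)" "1 \<le> real (Suc n) * (x - a)"
      using assms(2) by linarith+
    then show ?thesis by (simp add: plateau_def eq_1 del: of_nat_Suc)
  qed
qed

lemma plateau_smooth: "smooth (plateau a b n)"
proof -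
  have "plateau a b n = (\<lambda>x. \<sigma> (real (Suc n) * x + - (real (Suc n) * a)) - \<sigma> (real (Suc n) * x + - (real (Suc n) * b)))"
    by (simp add: fun_eq_iff plateau_def algebra_simps)
  with smooth_diff_affine[OF smooth] show ?thesis by metis
qed

lemma plateau_deriv:
  "deriv (plateau a b n) x = real (Suc n) * deriv \<sigma> (real (Suc n) * (x - a)) - real (Suc n) * deriv \<sigma> (real (Suc n) * (x - b))"
  unfolding plateau_def
  by (rule DERIV_imp_deriv)
    (rule derivative_eq_intros DERIV_chain2[OF smooth_DERIV[OF smooth]] refl | simp)+

lemma plateau_test_function:
  assumes "a \<le> b" "1 \<le> real (Suc n) * (d - b)" "-L < a" "d < L"
  shows "plateau a b n \<in> test_functions L"
  unfolding test_functions_def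
  using plateau_smooth[of a b n, unfolded smooth_def] plateau_support[OF assms(1,2)] assms(3,4)
  by (auto intro!: exI[of _ "{a..d}"])

end

section \<open>Functions with a weak derivative satisfy the fundamental theorem of calculus\<close>

lemma locally_integrable_Icc:
  "locally_integrable L g \<Longrightarrow> -L < a \<Longrightarrow> b < L \<Longrightarrow> set_integrable lborel {a..b} g"
  unfolding locally_integrable_def
  by (erule allE[of _ "{a..b}"]) (auto simp: subset_iff)

text \<open>The formula that defines the weak derivative is tested with \<open>plateau a b n\<close>. As \<open>n\<close> grows, the plateau
functions tend to the indicator function of \<open>(a, b]\<close>, while their derivatives act on the
continuous function \<open>u\<close> as a point evaluation at \<open>a\<close> minus one at \<open>b\<close>.\<close>

lemma weak_deriv_Ioc_integral:
  assumes wd: "has_weak_deriv L u g"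
    and cont: "continuous_on {-L..L} u"
    and ab: "-L < a" "a \<le> b" "b < L"
  shows "(LINT x:{a<..b}|lborel. g x) = u b - u a"
proof -
  obtain \<sigma> where "smooth_step \<sigma>" by (rule smooth_step_exists)
  then interpret smooth_step \<sigma> .
  define v where "v = (\<lambda>x. indicator {-L<..<L} x * u x)"
  have [measurable]: "v \<in> borel_measurable borel"
    unfolding v_def real_scaleR_def[symmetric]
    by (intro borel_measurable_continuous_on_indicator continuous_on_subset[OF cont]) auto
  have "bounded (u ` {-L..L})"
    using cont by (intro compact_imp_bounded compact_continuous_image) auto
  then obtain B where B: "B > 0" "\<And>x. x \<in> {-L..L} \<Longrightarrow> \<bar>u x\<bar> \<le> B"
    unfolding bounded_pos by auto
  have v_bound: "\<bar>v x\<bar> \<le> B" for x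
    using B by (auto simp: v_def indicator_def)
  have isCont: "isCont v c" if "-L < c" "c < L" for c
  proof -
    have "continuous_on {-L<..<L} v"
      unfolding v_def
      by (rule continuous_on_eq[OF continuous_on_subset[OF cont]]) auto
    with that show ?thesis by (simp add: continuous_on_eq_continuous_at)
  qed
  note ident = approximate_identity[OF \<open>v \<in> _\<close> v_bound isCont]
  \<comment> \<open>All plateau functions with large index are supported in \<open>[a, d]\<close>, away from \<open>L\<close>; on this
    compact interval \<open>g\<close> is integrable and serves as the dominating function.\<close>
  define d where "d = (b + L) / 2"
  have d: "b < d" "d < L" using ab by (auto simp: d_def)
  obtain N :: nat where N: "1 / (d - b) \<le> N" using real_arch_simple by blast
  have N': "1 \<le> real (Suc n) * (d - b)" if "n \<ge> N" for n
  proof -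
    have "1 / (d - b) \<le> real (Suc n)" using N that by linarith
    then show ?thesis using d by (simp add: divide_le_eq)
  qed
  have "(\<lambda>n. LINT x:{-L<..<L}|lborel. u x * deriv (plateau a b n) x) \<longlonglongrightarrow> v a - v b"
  proof -
    have "(LINT x:{-L<..<L}|lborel. u x * deriv (plateau a b n) x)
        = (LINT x|lborel. v x * (real (Suc n) * deriv \<sigma> (real (Suc n) * (x - a))))
        - (LINT x|lborel. v x * (real (Suc n) * deriv \<sigma> (real (Suc n) * (x - b))))" for n
    proof -
      have "(LINT x:{-L<..<L}|lborel. u x * deriv (plateau a b n) x)
         = (LINT x|lborel. v x * (real (Suc n) * deriv \<sigma> (real (Suc n) * (x - a)))
             - v x * (real (Suc n) * deriv \<sigma> (real (Suc n) * (x - b))))"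
        unfolding set_lebesgue_integral_def plateau_deriv v_def
        by (intro Bochner_Integration.integral_cong) (simp_all add: algebra_simps)
      also have "\<dots> = (LINT x|lborel. v x * (real (Suc n) * deriv \<sigma> (real (Suc n) * (x - a))))
        - (LINT x|lborel. v x * (real (Suc n) * deriv \<sigma> (real (Suc n) * (x - b))))"
        using ab by (intro Bochner_Integration.integral_diff ident) auto
      finally show ?thesis .
    qed
    moreover have "(\<lambda>n. (LINT x|lborel. v x * (real (Suc n) * deriv \<sigma> (real (Suc n) * (x - a))))
        - (LINT x|lborel. v x * (real (Suc n) * deriv \<sigma> (real (Suc n) * (x - b))))) \<longlonglongrightarrow> v a - v b"
      using ab by (intro tendsto_diff ident) auto
    ultimately show ?thesis by simp
  qed
  then have u_lim:
    "(\<lambda>n. LINT x:{-L<..<L}|lborel. u x * deriv (plateau a b (n + N)) x) \<longlonglongrightarrow> v a - v b"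
    by (rule LIMSEQ_ignore_initial_segment)
  have g_lim: "(\<lambda>n. LINT x:{-L<..<L}|lborel. g x * plateau a b (n + N) x)
      \<longlonglongrightarrow> (LINT x:{a<..b}|lborel. g x)"
  proof -
    have gd: "set_integrable lborel {a..d} g"
      using wd ab d by (intro locally_integrable_Icc) (auto simp: has_weak_deriv_def)
    let ?h = "\<lambda>x. indicator {a..d} x *\<^sub>R g x"
    have [measurable]: "plateau a b n \<in> borel_measurable borel" for n
      using plateau_smooth smooth_isCont
      by (intro borel_measurable_continuous_onI) (auto intro: continuous_at_imp_continuous_on)
    have [measurable]: "?h \<in> borel_measurable borel"
      using gd by (auto simp: set_integrable_def dest: borel_measurable_integrable)
    have "(\<lambda>n. LINT x|lborel. ?h x * plateau a b (n + N) x)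
        \<longlonglongrightarrow> (LINT x|lborel. ?h x * indicator {a<..b} x)"
    proof (rule integral_dominated_convergence[where w = "\<lambda>x. \<bar>?h x\<bar>"])
      show "integrable lborel (\<lambda>x. \<bar>?h x\<bar>)"
        using gd by (auto simp: set_integrable_def)
      show "AE x in lborel. (\<lambda>n. ?h x * plateau a b (n + N) x) \<longlonglongrightarrow> ?h x * indicator {a<..b} x"
        using LIMSEQ_ignore_initial_segment[OF plateau_tendsto[OF ab(2)]]
        by (intro AE_I2 tendsto_mult_left)
      show "AE x in lborel. norm (?h x * plateau a b (n + N) x) \<le> \<bar>?h x\<bar>" for n
        using plateau_bound by (intro AE_I2) (auto simp: abs_mult intro!: mult_left_le)
    qed measurable
    moreover have "(LINT x|lborel. ?h x * plateau a b (n + N) x)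
        = (LINT x:{-L<..<L}|lborel. g x * plateau a b (n + N) x)" for n
      unfolding set_lebesgue_integral_def
      using plateau_support[OF ab(2) N'[of "n + N"]] ab d
      by (intro Bochner_Integration.integral_cong) (auto simp: indicator_def)
    moreover have "(LINT x|lborel. ?h x * indicator {a<..b} x) = (LINT x:{a<..b}|lborel. g x)"
      unfolding set_lebesgue_integral_def
      using ab d by (intro Bochner_Integration.integral_cong) (auto simp: indicator_def)
    ultimately show ?thesis by simp
  qed
  have "(LINT x:{-L<..<L}|lborel. u x * deriv (plateau a b (n + N)) x)
      = - (LINT x:{-L<..<L}|lborel. g x * plateau a b (n + N) x)" for n
    using wd plateau_test_function[OF ab(2) N'[of "n + N"] ab(1) d(2)]
    by (auto simp: has_weak_deriv_def)
  then have "(\<lambda>n. LINT x:{-L<..<L}|lborel. u x * deriv (plateau a b (n + N)) x)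
      \<longlonglongrightarrow> - (LINT x:{a<..b}|lborel. g x)"
    using tendsto_minus[OF g_lim] by simp
  with u_lim have "v a - v b = - (LINT x:{a<..b}|lborel. g x)"
    by (rule LIMSEQ_unique)
  then show ?thesis using ab by (simp add: v_def)
qed

section \<open>Products of primitives\<close>

definition primitive :: "(real \<Rightarrow> real) \<Rightarrow> real \<Rightarrow> real" where
  "primitive f x = (LINT y:{..x}|lborel. f y)"

lemma set_integrable_if_integrable:
  fixes f :: "real \<Rightarrow> real"
  shows "integrable lborel f \<Longrightarrow> A \<in> sets borel \<Longrightarrow> set_integrable lborel A f"
  unfolding set_integrable_def by (rule integrable_mult_indicator) auto

lemma primitive_diff:
  assumes "integrable lborel f" "a \<le> b"
  shows "primitive f b - primitive f a = (LINT y:{a<..b}|lborel. f y)"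
proof -
  have "(LINT y:{..a} \<union> {a<..b}|lborel. f y) = (LINT y:{..a}|lborel. f y) + (LINT y:{a<..b}|lborel. f y)"
    using assms(1) by (intro set_integral_Un set_integrable_if_integrable) auto
  moreover have "{..a} \<union> {a<..b} = {..b}" using assms(2) by auto
  ultimately show ?thesis by (simp add: primitive_def)
qed

lemma primitive_bound:
  assumes "integrable lborel f"
  shows "\<bar>primitive f x\<bar> \<le> (LINT y|lborel. \<bar>f y\<bar>)"
proof -
  have "\<bar>primitive f x\<bar> \<le> (LINT y|lborel. \<bar>indicator {..x} y *\<^sub>R f y\<bar>)"
    unfolding primitive_def set_lebesgue_integral_def by (rule integral_abs_bound)
  also have "\<dots> \<le> (LINT y|lborel. \<bar>f y\<bar>)"
    using set_integrable_if_integrable[OF assms, of "{..x}"] assms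
    by (intro integral_mono) (auto simp: set_integrable_def indicator_def)
  finally show ?thesis .
qed

lemma primitive_continuous:
  assumes "integrable lborel f"
  shows "isCont (primitive f) x"
  unfolding continuous_at_sequentially o_def
proof (intro allI impI)
  fix X :: "nat \<Rightarrow> real" assume X: "X \<longlonglongrightarrow> x"
  show "(\<lambda>n. primitive f (X n)) \<longlonglongrightarrow> primitive f x"
    unfolding primitive_def set_lebesgue_integral_def
  proof (rule integral_dominated_convergence[where w = "\<lambda>y. \<bar>f y\<bar>"])
    show "AE y in lborel. (\<lambda>n. indicator {..X n} y *\<^sub>R f y) \<longlonglongrightarrow> indicator {..x} y *\<^sub>R f y"
      using AE_lborel_singleton[of x]
    proof eventually_elim
      case (elim y)
      have "\<forall>\<^sub>F n in sequentially. indicator {..X n} y = (indicator {..x} y :: real)"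
      proof (cases "y < x")
        case True
        show ?thesis using order_tendstoD(1)[OF X True] by eventually_elim (use True in auto)
      next
        case False
        with elim have "x < y" by simp
        show ?thesis using order_tendstoD(2)[OF X \<open>x < y\<close>]
          by eventually_elim (use \<open>x < y\<close> in auto)
      qed
      then show ?case
        by (intro tendsto_eventually) (auto elim: eventually_mono)
    qed
  qed (use assms in \<open>auto intro!: borel_measurable_integrable simp: indicator_def\<close>)
qed

lemma primitive_measurable:
  "integrable lborel f \<Longrightarrow> primitive f \<in> borel_measurable borel"
  by (intro borel_measurable_continuous_onI continuous_at_imp_continuous_on)
    (auto intro: primitive_continuous)

lemma integrable_mult_primitive:
  assumes f: "integrable lborel f" and g: "integrable lborel g"
  shows "integrable lborel (\<lambda>x. f x * primitive g x)"
proof (rule Bochner_Integration.integrable_bound)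
  show "integrable lborel (\<lambda>x. f x * (LINT y|lborel. \<bar>g y\<bar>))"
    using f by simp
  show "(\<lambda>x. f x * primitive g x) \<in> borel_measurable lborel"
    using f primitive_measurable[OF g] by measurable
  have "\<bar>primitive g x\<bar> \<le> \<bar>LINT y|lborel. \<bar>g y\<bar>\<bar>" for x
    using primitive_bound[OF g, of x] by linarith
  then show "AE x in lborel. norm (f x * primitive g x) \<le> norm (f x * (LINT y|lborel. \<bar>g y\<bar>))"
    by (auto simp: abs_mult intro!: mult_left_mono)
qed

text \<open>Integration by parts for primitives. The product of the two integrals is the integral of \<open>f x * g y\<close>
over the plane; the half-plane \<open>y \<le> x\<close> contributes the first summand and, after exchanging the order
of integration, the half-plane \<open>x \<le> y\<close> contributes the second. The common diagonal is a null set.\<close>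

lemma integral_mult_primitive:
  assumes f: "integrable lborel f" and g: "integrable lborel g"
  shows "(LINT x|lborel. f x * primitive g x + primitive f x * g x)
    = (LINT x|lborel. f x) * (LINT x|lborel. g x)"
proof -
  have [measurable]: "f \<in> borel_measurable borel" "g \<in> borel_measurable borel"
    using f g by (auto dest: borel_measurable_integrable)
  have "integrable (lborel \<Otimes>\<^sub>M lborel) (\<lambda>(x, y). f x * g y)"
  proof (rule lborel_pair.Fubini_integrable)
    show "integrable lborel (\<lambda>x. LINT y|lborel. norm (case (x, y) of (x, y) \<Rightarrow> f x * g y))"
      using f by (simp add: abs_mult)
  qed (use g in auto)
  then have K: "integrable (lborel \<Otimes>\<^sub>M lborel) (\<lambda>(x, y). f x * g y * (if x \<le> y then 1 else 0))"
    by (rule Bochner_Integration.integrable_bound) auto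
  have split: "primitive g x + (LINT y|lborel. g y * (if x \<le> y then 1 else 0)) = (LINT y|lborel. g y)" for x
  proof -
    have int: "integrable lborel (\<lambda>y. indicator {..x} y *\<^sub>R g y)"
      "integrable lborel (\<lambda>y. g y * (if x \<le> y then 1 else 0))"
      by (rule Bochner_Integration.integrable_bound[OF g]; auto simp: indicator_def)+
    have "primitive g x + (LINT y|lborel. g y * (if x \<le> y then 1 else 0))
        = (LINT y|lborel. indicator {..x} y *\<^sub>R g y + g y * (if x \<le> y then 1 else 0))"
      unfolding primitive_def set_lebesgue_integral_def using int by simp
    also have "\<dots> = (LINT y|lborel. g y)"
    proof (rule integral_cong_AE)
      show "AE y in lborel. indicator {..x} y *\<^sub>R g y + g y * (if x \<le> y then 1 else 0) = g y"
        using AE_lborel_singleton[of x] by eventually_elim auto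
    qed auto
    finally show ?thesis .
  qed
  have inner: "(LINT x|lborel. f x * g y * (if x \<le> y then 1 else 0)) = primitive f y * g y" for y
  proof -
    have "(LINT x|lborel. f x * g y * (if x \<le> y then 1 else 0))
        = (LINT x|lborel. (indicator {..y} x *\<^sub>R f x) * g y)"
      by (intro Bochner_Integration.integral_cong) auto
    then show ?thesis by (simp add: primitive_def set_lebesgue_integral_def)
  qed
  have Fg: "integrable lborel (\<lambda>x. primitive f x * g x)"
    using integrable_mult_primitive[OF g f] by (simp add: mult.commute)
  have "(LINT y|lborel. primitive f y * g y)
      = (LINT y|lborel. LINT x|lborel. f x * g y * (if x \<le> y then 1 else 0))"
    by (simp only: inner)
  also have "\<dots> = (LINT x|lborel. LINT y|lborel. f x * g y * (if x \<le> y then 1 else 0))"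
    using K by (rule lborel_pair.Fubini_integral)
  also have "\<dots> = (LINT x|lborel. f x * ((LINT y|lborel. g y) - primitive g x))"
  proof -
    have "(LINT y|lborel. g y * (if x \<le> y then 1 else 0)) = (LINT y|lborel. g y) - primitive g x" for x
      using split[of x] by linarith
    then show ?thesis by (simp only: mult.assoc integral_mult_right_zero)
  qed
  also have "\<dots> = (LINT x|lborel. f x) * (LINT y|lborel. g y) - (LINT x|lborel. f x * primitive g x)"
    using f integrable_mult_primitive[OF f g] by (simp add: right_diff_distrib)
  finally show ?thesis
    using integrable_mult_primitive[OF f g] Fg by simp
qed

lemma primitive_mult:
  assumes f: "integrable lborel f" and g: "integrable lborel g"
  shows "primitive f x * primitive g x = primitive (\<lambda>y. f y * primitive g y + primitive f y * g y) x"
proof -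
  \<comment> \<open>Cutting \<open>f\<close> and \<open>g\<close> off beyond \<open>x\<close> turns the statement into one about integrals over the whole line.\<close>
  define cut where "cut = (\<lambda>(h :: real \<Rightarrow> real) y. indicator {..x} y * h y)"
  have int: "integrable lborel (cut h)" if "integrable lborel h" for h
    using set_integrable_if_integrable[OF that, of "{..x}"] by (simp add: set_integrable_def cut_def)
  have total: "(LINT y|lborel. cut h y) = primitive h x" for h
    by (simp add: primitive_def set_lebesgue_integral_def cut_def)
  have before: "primitive (cut h) y = primitive h y" if "y \<le> x" for h y
    unfolding primitive_def cut_def
    by (rule set_lebesgue_integral_cong) (use that in auto)
  have "primitive f x * primitive g x
      = (LINT y|lborel. cut f y * primitive (cut g) y + primitive (cut f) y * cut g y)"
    using integral_mult_primitive[OF int[OF f] int[OF g]] by (simp add: total)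
  also have "\<dots> = (LINT y|lborel. cut (\<lambda>y. f y * primitive g y + primitive f y * g y) y)"
  proof (intro Bochner_Integration.integral_cong refl)
    fix y
    show "cut f y * primitive (cut g) y + primitive (cut f) y * cut g y
        = cut (\<lambda>y. f y * primitive g y + primitive f y * g y) y"
      by (cases "y \<le> x") (simp add: before, simp_all add: cut_def)
  qed
  finally show ?thesis by (simp add: total)
qed

section \<open>Primitives of integrable functions on an interval\<close>

text \<open>Extension by zero from the open interval, which turns integrals over \<open>(-L, L)\<close> into integrals over the
line and makes almost-everywhere statements about the interval into plain ones.\<close>

definition cutoff :: "real \<Rightarrow> (real \<Rightarrow> real) \<Rightarrow> real \<Rightarrow> real" where
  "cutoff L f x = indicator {-L<..<L} x * f x"

text \<open>The function \<open>u\<close> is absolutely continuous on \<open>[-L, L]\<close> with integrable derivative \<open>u'\<close>. The values of \<open>u\<close>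
outside the closed interval, and those of \<open>u'\<close> outside the open one, are unconstrained.\<close>

definition has_L1_deriv :: "real \<Rightarrow> (real \<Rightarrow> real) \<Rightarrow> (real \<Rightarrow> real) \<Rightarrow> bool" where
  "has_L1_deriv L u u' \<longleftrightarrow> integrable lborel (cutoff L u') \<and>
     (\<forall>x\<in>{-L..L}. u x = u (-L) + primitive (cutoff L u') x)"

lemma has_L1_derivI:
  "integrable lborel (cutoff L u') \<Longrightarrow>
    (\<And>x. x \<in> {-L..L} \<Longrightarrow> u x = u (-L) + primitive (cutoff L u') x) \<Longrightarrow> has_L1_deriv L u u'"
  unfolding has_L1_deriv_def by blast

lemma has_L1_deriv_integrable: "has_L1_deriv L u u' \<Longrightarrow> integrable lborel (cutoff L u')"
  by (simp add: has_L1_deriv_def)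

lemma has_L1_deriv_eq:
  "has_L1_deriv L u u' \<Longrightarrow> x \<in> {-L..L} \<Longrightarrow> u x = u (-L) + primitive (cutoff L u') x"
  unfolding has_L1_deriv_def by blast

lemma set_integral_eq_cutoff: "(LINT x:{-L<..<L}|lborel. f x) = (LINT x|lborel. cutoff L f x)"
  by (simp add: set_lebesgue_integral_def cutoff_def)

lemma set_integrable_eq_cutoff: "set_integrable lborel {-L<..<L} f \<longleftrightarrow> integrable lborel (cutoff L f)"
  by (simp add: set_integrable_def cutoff_def[abs_def])

lemma integrable_cutoff_mult_continuous:
  assumes f: "integrable lborel (cutoff L f)" and g: "continuous_on {-L..L} g"
  shows "integrable lborel (cutoff L (\<lambda>x. f x * g x))"
proof -
  have "bounded (g ` {-L..L})"
    using g by (intro compact_imp_bounded compact_continuous_image) auto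
  then obtain B where "\<forall>x\<in>{-L..L}. norm (g x) \<le> B"
    unfolding bounded_iff by blast
  then have B: "\<bar>g x\<bar> \<le> B" if "x \<in> {-L..L}" for x
    using that by simp
  have [measurable]: "cutoff L g \<in> borel_measurable borel"
    unfolding cutoff_def[abs_def] real_scaleR_def[symmetric]
    by (intro borel_measurable_continuous_on_indicator continuous_on_subset[OF g]) auto
  have "integrable lborel (\<lambda>x. cutoff L f x * cutoff L g x)"
  proof (rule Bochner_Integration.integrable_bound)
    show "integrable lborel (\<lambda>x. B * cutoff L f x)" using f by simp
    show "AE x in lborel. norm (cutoff L f x * cutoff L g x) \<le> norm (B * cutoff L f x)"
    proof (rule AE_I2)
      fix x
      show "norm (cutoff L f x * cutoff L g x) \<le> norm (B * cutoff L f x)"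
      proof (cases "x \<in> {-L<..<L}")
        case True
        then have "\<bar>g x\<bar> \<le> \<bar>B\<bar>" using B[of x] by simp
        then have "\<bar>f x\<bar> * \<bar>g x\<bar> \<le> \<bar>f x\<bar> * \<bar>B\<bar>" by (rule mult_left_mono) simp
        with True show ?thesis by (simp add: cutoff_def abs_mult mult.commute)
      qed (simp add: cutoff_def)
    qed
  qed (use f in measurable)
  also have "(\<lambda>x. cutoff L f x * cutoff L g x) = cutoff L (\<lambda>x. f x * g x)"
    by (auto simp: cutoff_def indicator_def)
  finally show ?thesis .
qed

lemma has_L1_deriv_continuous:
  assumes "has_L1_deriv L u u'"
  shows "continuous_on {-L..L} u"
proof -
  have "continuous_on {-L..L} (\<lambda>x. u (-L) + primitive (cutoff L u') x)"
    using has_L1_deriv_integrable[OF assms] by (auto intro!: continuous_intros continuous_at_imp_continuous_on primitive_continuous)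
  then show ?thesis
    by (rule continuous_on_eq) (rule has_L1_deriv_eq[OF assms, symmetric])
qed

lemma primitive_cutoff_left: "primitive (cutoff L f) (-L) = 0"
proof -
  have "primitive (cutoff L f) (-L) = (LINT y:{..-L}|lborel. 0)"
    unfolding primitive_def by (rule set_lebesgue_integral_cong) (auto simp: cutoff_def)
  then show ?thesis by simp
qed

lemma has_L1_deriv_integral:
  assumes "has_L1_deriv L u u'" "L > 0"
  shows "(LINT x:{-L<..<L}|lborel. u' x) = u L - u (-L)"
proof -
  have "primitive (cutoff L u') L = (LINT x|lborel. cutoff L u' x)"
    unfolding primitive_def set_lebesgue_integral_def
    by (intro Bochner_Integration.integral_cong) (auto simp: cutoff_def indicator_def)
  then show ?thesis
    using has_L1_deriv_eq[OF assms(1), of L] assms(2) by (simp add: set_integral_eq_cutoff)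
qed

lemma primitive_add:
  "integrable lborel f \<Longrightarrow> integrable lborel g \<Longrightarrow>
    primitive (\<lambda>y. f y + g y) x = primitive f x + primitive g x"
  unfolding primitive_def by (intro set_integral_add set_integrable_if_integrable) auto

lemma primitive_cmult: "primitive (\<lambda>y. c * f y) x = c * primitive f x"
  by (simp add: primitive_def)

lemma has_L1_deriv_add:
  assumes "has_L1_deriv L u u'" "has_L1_deriv L v v'"
  shows "has_L1_deriv L (\<lambda>x. u x + v x) (\<lambda>x. u' x + v' x)"
proof -
  have eq: "cutoff L (\<lambda>x. u' x + v' x) = (\<lambda>x. cutoff L u' x + cutoff L v' x)"
    by (simp add: cutoff_def fun_eq_iff distrib_left)
  have "u x + v x = (u (-L) + v (-L)) + primitive (cutoff L (\<lambda>x. u' x + v' x)) x"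
    if "x \<in> {-L..L}" for x
    unfolding eq
    using has_L1_deriv_eq[OF assms(1) that] has_L1_deriv_eq[OF assms(2) that]
    by (simp add: primitive_add has_L1_deriv_integrable[OF assms(1)] has_L1_deriv_integrable[OF assms(2)])
  moreover have "integrable lborel (cutoff L (\<lambda>x. u' x + v' x))"
    unfolding eq using has_L1_deriv_integrable[OF assms(1)] has_L1_deriv_integrable[OF assms(2)]
    by (rule Bochner_Integration.integrable_add)
  ultimately show ?thesis by (intro has_L1_derivI)
qed

lemma has_L1_deriv_cmult:
  assumes "has_L1_deriv L u u'"
  shows "has_L1_deriv L (\<lambda>x. c * u x) (\<lambda>x. c * u' x)"
proof -
  have eq: "cutoff L (\<lambda>x. c * u' x) = (\<lambda>x. c * cutoff L u' x)"
    by (simp add: cutoff_def fun_eq_iff)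
  have "c * u x = c * u (-L) + primitive (cutoff L (\<lambda>x. c * u' x)) x" if "x \<in> {-L..L}" for x
    unfolding eq primitive_cmult has_L1_deriv_eq[OF assms that] by (rule distrib_left)
  moreover have "integrable lborel (cutoff L (\<lambda>x. c * u' x))"
    unfolding eq using has_L1_deriv_integrable[OF assms] by simp
  ultimately show ?thesis by (intro has_L1_derivI)
qed

text \<open>A primitive on the interval is a constant plus a \<open>primitive\<close> from \<open>-\<infinity>\<close>. Expanding the product of two such
sums leaves one product of primitives, which \<open>primitive_mult\<close> handles.\<close>

lemma has_L1_deriv_mult:
  assumes u: "has_L1_deriv L u u'" and v: "has_L1_deriv L v v'"
  shows "has_L1_deriv L (\<lambda>x. u x * v x) (\<lambda>x. u' x * v x + u x * v' x)"
proof -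
  define f where "f = cutoff L u'"
  define g where "g = cutoff L v'"
  have int: "integrable lborel f" "integrable lborel g"
    and u_eq: "\<And>x. x \<in> {-L..L} \<Longrightarrow> u x = u (-L) + primitive f x"
    and v_eq: "\<And>x. x \<in> {-L..L} \<Longrightarrow> v x = v (-L) + primitive g x"
    unfolding f_def g_def by (rule has_L1_deriv_integrable[OF u] has_L1_deriv_integrable[OF v]
        has_L1_deriv_eq[OF u] has_L1_deriv_eq[OF v]; assumption)+
  have eq: "cutoff L (\<lambda>x. u' x * v x + u x * v' x)
      = (\<lambda>x. (v (-L) * f x + u (-L) * g x) + (f x * primitive g x + primitive f x * g x))"
  proof
    fix x
    show "cutoff L (\<lambda>x. u' x * v x + u x * v' x) x
      = (v (-L) * f x + u (-L) * g x) + (f x * primitive g x + primitive f x * g x)"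
    proof (cases "x \<in> {-L<..<L}")
      case True
      then show ?thesis
        unfolding f_def[THEN fun_cong, of x] g_def[THEN fun_cong, of x]
        using u_eq[of x] v_eq[of x] by (simp add: cutoff_def algebra_simps)
    qed (simp add: cutoff_def f_def g_def)
  qed
  have int_fg: "integrable lborel (\<lambda>x. f x * primitive g x + primitive f x * g x)"
    using integrable_mult_primitive[OF int] integrable_mult_primitive[OF int(2,1)]
    by (simp add: mult.commute)
  have "u x * v x = u (-L) * v (-L) + primitive (cutoff L (\<lambda>x. u' x * v x + u x * v' x)) x"
    if "x \<in> {-L..L}" for x
  proof -
    have "primitive (cutoff L (\<lambda>x. u' x * v x + u x * v' x)) x
       = v (-L) * primitive f x + u (-L) * primitive g x + primitive f x * primitive g x"
      unfolding eq primitive_mult[OF int] using int int_fg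
      by (simp add: primitive_add primitive_cmult)
    then show ?thesis
      unfolding u_eq[OF that] v_eq[OF that] by (simp add: algebra_simps)
  qed
  moreover have "integrable lborel (cutoff L (\<lambda>x. u' x * v x + u x * v' x))"
    unfolding eq using int int_fg by simp
  ultimately show ?thesis unfolding has_L1_deriv_def by blast
qed

lemma has_L1_deriv_smooth:
  assumes "smooth \<phi>"
  shows "has_L1_deriv L \<phi> (deriv \<phi>)"
proof -
  have FTC: "has_bochner_integral lborel (\<lambda>y. deriv \<phi> y * indicator {-L..x} y) (\<phi> x - \<phi> (-L))"
    if "-L \<le> x" for x
    by (rule has_bochner_integral_FTC_Icc_real)
      (use that assms smooth_DERIV smooth_isCont smooth_deriv in auto)
  have "set_integrable lborel {-L..L} (deriv \<phi>)"
    using assms smooth_deriv smooth_isCont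
    by (intro borel_integrable_atLeastAtMost' continuous_at_imp_continuous_on) blast
  then have "set_integrable lborel {-L<..<L} (deriv \<phi>)"
    by (rule set_integrable_subset) auto
  then have int: "integrable lborel (cutoff L (deriv \<phi>))"
    by (simp add: set_integrable_eq_cutoff)
  have "primitive (cutoff L (deriv \<phi>)) x = \<phi> x - \<phi> (-L)" if x: "x \<in> {-L..L}" for x
  proof -
    have "primitive (cutoff L (deriv \<phi>)) x = (LINT y|lborel. deriv \<phi> y * indicator {-L..x} y)"
      unfolding primitive_def set_lebesgue_integral_def
    proof (rule integral_cong_AE)
      show "AE y in lborel. indicator {..x} y *\<^sub>R cutoff L (deriv \<phi>) y = deriv \<phi> y * indicator {-L..x} y"
        using AE_lborel_singleton[of "-L"] AE_lborel_singleton[of L]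
        by eventually_elim (use x in \<open>auto simp: cutoff_def indicator_def\<close>)
      show "(\<lambda>y. indicator {..x} y *\<^sub>R cutoff L (deriv \<phi>) y) \<in> borel_measurable lborel"
        using int by measurable
      show "(\<lambda>y. deriv \<phi> y * indicator {-L..x} y) \<in> borel_measurable lborel"
        using FTC[of x] x by (auto simp: has_bochner_integral_iff)
    qed
    with FTC[of x] x show ?thesis by (auto simp: has_bochner_integral_iff)
  qed
  then have "\<phi> x = \<phi> (-L) + primitive (cutoff L (deriv \<phi>)) x" if "x \<in> {-L..L}" for x
    using that by (simp only: add_diff_cancel_left' diff_add_cancel add.commute)
  with int show ?thesis unfolding has_L1_deriv_def by blast
qed

section \<open>Uniqueness and existence of weak derivatives\<close>

text \<open>Half-open intervals form an intersection-stable generator of the Borel sets, so the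
\<open>\<pi>\<close>-\<open>\<lambda>\<close> theorem extends the vanishing of the integral to all Borel sets, in particular to
those where \<open>f\<close> has a constant sign.\<close>

lemma AE_zero_if_Ioc_integrals_zero:
  fixes f :: "real \<Rightarrow> real"
  assumes f: "integrable lborel f"
    and zero: "\<And>a b. a < b \<Longrightarrow> (LINT x:{a<..b}|lborel. f x) = 0"
  shows "AE x in lborel. f x = 0"
proof -
  have si: "set_integrable lborel A f" if "A \<in> sets lborel" for A
    unfolding set_integrable_def using that f by (rule integrable_mult_indicator)
  have zero': "(LINT x:{a<..b}|lborel. f x) = 0" for a b
    using zero[of a b] by (cases "a < b") (auto simp: set_lebesgue_integral_def)
  have "(\<lambda>n. LINT x:{- real n<..real n}|lborel. f x) \<longlonglongrightarrow>
      (LINT x:(\<Union>n. {- real n<..real n})|lborel. f x)"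
  proof (rule set_integral_cont_up)
    show "incseq (\<lambda>n. {- real n<..real n})"
      by (auto simp: incseq_def)
  qed (use si in auto)
  moreover have "(\<Union>n. {- real n<..real n}) = UNIV"
  proof -
    have "\<exists>n. x \<in> {- real n<..real n}" for x
    proof -
      obtain n where "\<bar>x\<bar> < real n" using reals_Archimedean2 by blast
      then show ?thesis by (intro exI[of _ n]) auto
    qed
    then show ?thesis by auto
  qed
  ultimately have all: "(LINT x:UNIV|lborel. f x) = 0"
    by (simp add: zero' LIMSEQ_const_iff)
  let ?G = "range (\<lambda>(a, b). {a<..b::real})"
  have sets: "sets lborel = sigma_sets UNIV ?G"
    by (metis borel_sigma_sets_Ioc sets_lborel sets_measure_of top_greatest Pow_UNIV)
  have stable: "Int_stable ?G"
    by (auto simp: Int_stable_def)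
  have "(LINT x:A|lborel. f x) = 0" if "A \<in> sets lborel" for A
    using stable subset_UNIV[of ?G, folded Pow_UNIV] that[unfolded sets]
  proof (induction rule: sigma_sets_induct_disjoint)
    case (compl A)
    then have "A \<in> sets lborel" by (simp only: sets)
    then have "(LINT x:(UNIV - A) \<union> A|lborel. f x)
        = (LINT x:UNIV - A|lborel. f x) + (LINT x:A|lborel. f x)"
      by (intro set_integral_Un si) auto
    with all compl show ?case by simp
  next
    case (union A)
    then have "A i \<in> sets lborel" for i unfolding sets by auto
    then have "(LINT x:(\<Union>i. A i)|lborel. f x) = (\<Sum>i. LINT x:A i|lborel. f x)"
      using union(1) by (intro lebesgue_integral_countable_add si)
        (auto simp: disjoint_family_on_def)
    with union show ?case by simp
  next
    case empty
    show ?case by (simp add: set_lebesgue_integral_def)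
  qed (auto simp: zero')
  then show ?thesis
    using density_unique_real[OF f integrable_zero] by simp
qed

text \<open>The integral of \<open>(u \<phi>)'\<close> over the interval is a difference of boundary values, and the test function
\<open>\<phi>\<close> vanishes at both ends.\<close>

lemma has_L1_deriv_imp_has_weak_deriv:
  assumes u: "has_L1_deriv L u u'" and "L > 0"
  shows "has_weak_deriv L u u'"
  unfolding has_weak_deriv_def
proof (intro conjI ballI)
  have "set_integrable lborel {-L..L} u"
    by (intro borel_integrable_atLeastAtMost' has_L1_deriv_continuous[OF u])
  then show "locally_integrable L u"
    unfolding locally_integrable_def
    by (auto intro!: set_integrable_subset[of lborel "{-L..L}"] borel_compact)
  have "set_integrable lborel {-L<..<L} u'"
    using u by (simp add: has_L1_deriv_def set_integrable_eq_cutoff)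
  then show "locally_integrable L u'"
    unfolding locally_integrable_def
    by (auto intro!: set_integrable_subset[of lborel "{-L<..<L}"] borel_compact)
next
  fix \<phi> assume \<phi>: "\<phi> \<in> test_functions L"
  then have "smooth \<phi>" by (simp add: test_functions_def smooth_def)
  then have d: "has_L1_deriv L \<phi> (deriv \<phi>)" by (rule has_L1_deriv_smooth)
  have ends: "\<phi> L = 0" "\<phi> (-L) = 0"
    using \<phi> by (auto simp: test_functions_def)
  have int: "integrable lborel (cutoff L (\<lambda>x. u' x * \<phi> x))" "integrable lborel (cutoff L (\<lambda>x. u x * deriv \<phi> x))"
    using integrable_cutoff_mult_continuous[OF has_L1_deriv_integrable[OF u] has_L1_deriv_continuous[OF d]]
      integrable_cutoff_mult_continuous[OF has_L1_deriv_integrable[OF d] has_L1_deriv_continuous[OF u]]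
    by (simp_all add: mult.commute)
  have "(LINT x:{-L<..<L}|lborel. u' x * \<phi> x + u x * deriv \<phi> x) = 0"
    using has_L1_deriv_integral[OF has_L1_deriv_mult[OF u d] \<open>L > 0\<close>] ends by simp
  then show "(LINT x:{-L<..<L}|lborel. u x * deriv \<phi> x) = - (LINT x:{-L<..<L}|lborel. u' x * \<phi> x)"
    using int by (simp add: set_integral_add set_integrable_eq_cutoff)
qed

text \<open>On the open interval \<open>u\<close> and the primitive of \<open>g\<close> have equal increments, so their difference is constant
there. By continuity it is constant up to the endpoints, which gives access to the traces of \<open>u\<close>.\<close>

lemma has_weak_deriv_imp_has_L1_deriv:
  assumes wd: "has_weak_deriv L u g" and cont: "continuous_on {-L..L} u"
    and int: "set_integrable lborel {-L<..<L} g" and "L > 0"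
  shows "has_L1_deriv L u g"
proof -
  define D where "D x = u x - primitive (cutoff L g) x" for x
  have int': "integrable lborel (cutoff L g)" using int by (simp add: set_integrable_eq_cutoff)
  have "continuous_on {-L..L} D"
    unfolding D_def
    by (intro continuous_on_diff cont continuous_at_imp_continuous_on ballI primitive_continuous int')
  then have contD: "continuous_on (closure {-L<..<L}) D" using \<open>L > 0\<close> by simp
  have le: "D a = D b" if "-L < a" "a \<le> b" "b < L" for a b
  proof -
    have "(LINT y:{a<..b}|lborel. cutoff L g y) = (LINT y:{a<..b}|lborel. g y)"
      by (rule set_lebesgue_integral_cong) (use that in \<open>auto simp: cutoff_def\<close>)
    then show ?thesis
      using weak_deriv_Ioc_integral[OF wd cont that] primitive_diff[OF int' that(2)]
      by (simp add: D_def)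
  qed
  have "D x = D 0" if "x \<in> {-L<..<L}" for x
    using le[of x 0] le[of 0 x] that \<open>L > 0\<close> by (cases "x \<le> 0") auto
  then have const: "D x = D 0" if "x \<in> {-L..L}" for x
    by (rule continuous_constant_on_closure[OF contD]) (use that \<open>L > 0\<close> in simp_all)
  show ?thesis
    unfolding has_L1_deriv_def
  proof (intro conjI ballI int')
    fix x assume "x \<in> {-L..L}"
    then have "D x = D (-L)" using const[of x] const[of "-L"] \<open>L > 0\<close> by simp
    then show "u x = u (-L) + primitive (cutoff L g) x"
      by (simp add: D_def primitive_cutoff_left)
  qed
qed

text \<open>Weak derivatives are only locally integrable, so the comparison of interval integrals is made on
compact subintervals \<open>[c, d]\<close>; countably many of these exhaust \<open>(-L, L)\<close>.\<close>

lemma weak_deriv_unique: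
  assumes g: "has_weak_deriv L u g" and h: "has_weak_deriv L u h"
    and cont: "continuous_on {-L..L} u"
  shows "AE x in lborel. cutoff L g x = cutoff L h x"
proof (cases "L > 0")
  case True
  have eq: "AE x in lborel. x \<in> {c<..d} \<longrightarrow> g x = h x" if cd: "-L < c" "d < L" for c d
  proof -
    have int: "set_integrable lborel {c..d} g" "set_integrable lborel {c..d} h"
      using g h cd by (auto simp: has_weak_deriv_def intro: locally_integrable_Icc)
    have sub: "set_integrable lborel {a<..b} g" "set_integrable lborel {a<..b} h"
      if "c \<le> a" "b \<le> d" for a b
      by (rule set_integrable_subset[OF int(1)] set_integrable_subset[OF int(2)]; use that in auto)+
    have "AE x in lborel. indicator {c<..d} x * (g x - h x) = 0"
    proof (rule AE_zero_if_Ioc_integrals_zero)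
      have "set_integrable lborel {c<..d} (\<lambda>x. g x - h x)"
        by (intro set_integral_diff sub) auto
      then show "integrable lborel (\<lambda>x. indicator {c<..d} x * (g x - h x))"
        by (simp add: set_integrable_def)
    next
      fix a b :: real
      define a' b' where "a' = max a c" and "b' = min b d"
      have "(LINT x:{a<..b}|lborel. indicator {c<..d} x * (g x - h x))
          = (LINT x:{a'<..b'}|lborel. g x - h x)"
        unfolding set_lebesgue_integral_def
        by (intro Bochner_Integration.integral_cong) (auto simp: a'_def b'_def indicator_def)
      also have "\<dots> = 0"
      proof (cases "a' \<le> b'")
        case True
        have "(LINT x:{a'<..b'}|lborel. g x - h x)
            = (LINT x:{a'<..b'}|lborel. g x) - (LINT x:{a'<..b'}|lborel. h x)"
          by (intro set_integral_diff sub) (auto simp: a'_def b'_def)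
        also have "\<dots> = 0"
          using weak_deriv_Ioc_integral[OF g cont _ True] weak_deriv_Ioc_integral[OF h cont _ True] cd
          by (auto simp: a'_def b'_def)
        finally show ?thesis .
      qed (simp add: set_lebesgue_integral_def)
      finally show "(LINT x:{a<..b}|lborel. indicator {c<..d} x * (g x - h x)) = 0" .
    qed
    then show ?thesis by eventually_elim (auto simp: indicator_def)
  qed
  have "AE x in lborel. \<forall>n. x \<in> {-L + L / real (n + 2)<..L - L / real (n + 2)} \<longrightarrow> g x = h x"
    unfolding AE_all_countable by (intro allI eq) (use True in simp_all)
  then show ?thesis
  proof eventually_elim
    case (elim x)
    show ?case
    proof (cases "x \<in> {-L<..<L}")
      case x: True
      then have pos: "L - \<bar>x\<bar> > 0" by auto
      obtain n :: nat where "L / (L - \<bar>x\<bar>) < n" using reals_Archimedean2 by blast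
      then have "L / (L - \<bar>x\<bar>) < real (n + 2)" by linarith
      then have "L / real (n + 2) < L - \<bar>x\<bar>" using pos by (simp add: field_simps)
      then have "x \<in> {-L + L / real (n + 2)<..L - L / real (n + 2)}" by auto
      with elim have "g x = h x" by blast
      then show ?thesis by (simp add: cutoff_def)
    qed (simp add: cutoff_def)
  qed
qed (simp add: cutoff_def)

text \<open>Local integrability gives measurability on each compact subinterval; the extension by zero is the
pointwise limit of the restrictions to an exhausting sequence of them.\<close>

lemma locally_integrable_measurable:
  assumes g: "locally_integrable L g" and "L > 0"
  shows "cutoff L g \<in> borel_measurable borel"
proof (rule borel_measurable_LIMSEQ_real)
  let ?I = "\<lambda>n :: nat. {-L + L / real (n + 2)..L - L / real (n + 2)}"
  show "(\<lambda>x. indicator (?I n) x * g x) \<in> borel_measurable borel" for n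
  proof -
    have "set_integrable lborel (?I n) g"
      using g by (rule locally_integrable_Icc) (use \<open>L > 0\<close> in auto)
    then show ?thesis by (auto simp: set_integrable_def dest: borel_measurable_integrable)
  qed
  show "(\<lambda>n. indicator (?I n) x * g x) \<longlonglongrightarrow> cutoff L g x" for x
  proof (cases "x \<in> {-L<..<L}")
    case x: True
    then have pos: "L - \<bar>x\<bar> > 0" by auto
    obtain N :: nat where N: "L / (L - \<bar>x\<bar>) < N" using reals_Archimedean2 by blast
    have "x \<in> ?I n" if "n \<ge> N" for n
    proof -
      have "L / (L - \<bar>x\<bar>) < real (n + 2)" using N that by linarith
      then have "L / real (n + 2) < L - \<bar>x\<bar>" using pos by (simp add: field_simps)
      then show ?thesis by auto
    qed
    then have "indicator (?I n) x * g x = cutoff L g x" if "n \<ge> N" for n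
      using x that by (simp only: cutoff_def indicator_simps)
    then show ?thesis by (intro tendsto_eventually eventually_sequentiallyI)
  next
    case False
    have "x \<notin> ?I n" for n
    proof -
      have "L / real (n + 2) > 0" using \<open>L > 0\<close> by simp
      with False show ?thesis by auto
    qed
    with False show ?thesis by (simp add: cutoff_def)
  qed
qed

text \<open>The bridge to the chosen representative \<open>weak_deriv L u\<close>: once any integrable derivative is known, the
chosen one agrees with it almost everywhere and is itself an integrable derivative.\<close>

lemma has_L1_deriv_weak_deriv:
  assumes u: "has_L1_deriv L u u'" and "L > 0"
  shows "AE x in lborel. cutoff L (weak_deriv L u) x = cutoff L u' x"
    and "has_L1_deriv L u (weak_deriv L u)"
proof -
  have wd': "has_weak_deriv L u u'"
    using u \<open>L > 0\<close> by (rule has_L1_deriv_imp_has_weak_deriv)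
  then have wd: "has_weak_deriv L u (weak_deriv L u)"
    unfolding weak_deriv_def by (rule someI[of "has_weak_deriv L u"])
  show AE: "AE x in lborel. cutoff L (weak_deriv L u) x = cutoff L u' x"
    using wd wd' has_L1_deriv_continuous[OF u] by (rule weak_deriv_unique)
  have "cutoff L (weak_deriv L u) \<in> borel_measurable borel"
    using wd \<open>L > 0\<close> by (intro locally_integrable_measurable) (auto simp: has_weak_deriv_def)
  then have "integrable lborel (cutoff L (weak_deriv L u))"
    using has_L1_deriv_integrable[OF u] AE
    by (subst integrable_cong_AE[where g = "cutoff L u'"]) auto
  then show "has_L1_deriv L u (weak_deriv L u)"
    using wd has_L1_deriv_continuous[OF u] \<open>L > 0\<close>
    by (intro has_weak_deriv_imp_has_L1_deriv) (auto simp: set_integrable_eq_cutoff)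
qed

lemma square_integrable_imp_integrable:
  assumes "square_integrable L f"
  shows "integrable lborel (cutoff L f)"
proof (rule Bochner_Integration.integrable_bound)
  have "set_integrable lborel {-L<..<L} (\<lambda>_. 1 :: real)"
    by (rule set_integrable_subset[OF borel_integrable_atLeastAtMost'[of "-L" L]]) auto
  then have "set_integrable lborel {-L<..<L} (\<lambda>x. 1 + (f x)\<^sup>2)"
    using assms by (intro set_integral_add(1)) (simp_all add: square_integrable_def)
  then show "integrable lborel (cutoff L (\<lambda>x. 1 + (f x)\<^sup>2))"
    by (simp add: set_integrable_eq_cutoff)
  show "cutoff L f \<in> borel_measurable lborel"
    using assms by (auto simp: square_integrable_def set_borel_measurable_def cutoff_def[abs_def])
  have "\<bar>y\<bar> \<le> 1 + y\<^sup>2" for y :: real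
    using sum_power2_ge_zero[of "\<bar>y\<bar> - 1" 0] abs_ge_zero[of y] by (simp add: power2_eq_square algebra_simps)
  then show "AE x in lborel. norm (cutoff L f x) \<le> norm (cutoff L (\<lambda>x. 1 + (f x)\<^sup>2) x)"
    by (auto simp: cutoff_def indicator_def)
qed

text \<open>The space \<open>H1\<close> provides some square integrable weak derivative; by uniqueness, square integrability
passes to the chosen one.\<close>

lemma H1_weak_deriv:
  assumes "u \<in> H1 L" "L > 0"
  shows "has_L1_deriv L u (weak_deriv L u)"
    and "integrable lborel (cutoff L (\<lambda>x. (weak_deriv L u x)\<^sup>2))"
proof -
  obtain g where g: "has_weak_deriv L u g" "square_integrable L g"
    and cont: "continuous_on {-L..L} u"
    using assms(1) by (auto simp: H1_def)
  have "has_L1_deriv L u g"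
    using g cont assms(2) square_integrable_imp_integrable
    by (intro has_weak_deriv_imp_has_L1_deriv) (auto simp: set_integrable_eq_cutoff)
  note wd = has_L1_deriv_weak_deriv[OF this assms(2)]
  show d: "has_L1_deriv L u (weak_deriv L u)" by fact
  have sq: "cutoff L (\<lambda>x. (f x)\<^sup>2) = (\<lambda>x. (cutoff L f x)\<^sup>2)" for f
    by (auto simp: cutoff_def indicator_def)
  have "integrable lborel (\<lambda>x. (cutoff L g x)\<^sup>2)"
    unfolding sq[symmetric] using g(2) by (simp add: square_integrable_def set_integrable_eq_cutoff)
  moreover have "cutoff L (weak_deriv L u) \<in> borel_measurable lborel"
    using has_L1_deriv_integrable[OF d] by (rule borel_measurable_integrable)
  ultimately show "integrable lborel (cutoff L (\<lambda>x. (weak_deriv L u x)\<^sup>2))"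
    unfolding sq using wd(1)
    by (subst integrable_cong_AE[where g = "\<lambda>x. (cutoff L g x)\<^sup>2"])
      (auto dest: borel_measurable_integrable)
qed

section \<open>Conservation of energy\<close>

text \<open>The nonlinear term of the scheme does no work: with \<open>h = (q u)'\<close>, the integrand \<open>(q u' + h) u\<close> is the
derivative of \<open>(q u) u\<close>, which vanishes at \<open>-L\<close> because of \<open>u\<close> and at \<open>L\<close> because of \<open>q\<close>.\<close>

lemma transport_integral_zero:
  assumes "L > 0" and q: "has_L1_deriv L q q'" and u: "has_L1_deriv L u u'"
    and bdry: "u (-L) = 0" "q L = 0"
    and h: "has_L1_deriv L (\<lambda>x. q x * u x) h"
  shows "bracket L (\<lambda>x. q x * u' x + h x) u = 0"
proof -
  have "has_L1_deriv L (\<lambda>x. (q x * u x) * u x) (\<lambda>x. h x * u x + (q x * u x) * u' x)"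
    using h u by (rule has_L1_deriv_mult)
  from has_L1_deriv_integral[OF this \<open>L > 0\<close>] bdry show ?thesis
    by (simp add: bracket_def algebra_simps)
qed

theorem proposition2:
  fixes L dt :: real
    and X1d X2d :: "(real \<Rightarrow> real) set"
    and u_old u_new u_half q_half :: "real \<Rightarrow> real"
  assumes "L > 0" and "dt > 0"
    and "finite_dimensional_subspace X1d" and "X1d \<subseteq> X1 L"
    and "finite_dimensional_subspace X2d" and "X2d \<subseteq> X2 L"
    and "u_old \<in> X1d" and "u_new \<in> X1d" and "q_half \<in> X2d"
    and "u_half = (\<lambda>x. 1 / 2 * (u_old x + u_new x))"
    and "\<And>v1. v1 \<in> X1d \<Longrightarrow>
           bracket L (\<lambda>x. (weak_deriv L u_new x - weak_deriv L u_old x) / dt) (weak_deriv L v1) =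
           bracket L (\<lambda>x. q_half x * weak_deriv L u_half x +
                          weak_deriv L (\<lambda>y. q_half y * u_half y) x) v1"
    and "\<And>v2. v2 \<in> X2d \<Longrightarrow>
           bracket L q_half v2 = - bracket L (weak_deriv L u_half) (weak_deriv L v2)"
  shows "(LINT x:{-L<..<L}|lborel. 1 / 2 * (weak_deriv L u_new x)\<^sup>2) =
         (LINT x:{-L<..<L}|lborel. 1 / 2 * (weak_deriv L u_old x)\<^sup>2)"
proof -
  note L = \<open>L > 0\<close>
  have H1: "u_old \<in> H1 L" "u_new \<in> H1 L" "q_half \<in> H1 L"
    and bdry: "u_old (-L) = 0" "u_new (-L) = 0" "q_half L = 0"
    using assms(4,6-9) by (auto simp: X1_def X2_def)
  have "subspace X1d" using assms(3) by (simp add: finite_dimensional_subspace_def)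
  then have "(1 / 2) *\<^sub>R (u_old + u_new) \<in> X1d"
    using assms(7,8) by (intro subspace_scale subspace_add)
  also have "(1 / 2) *\<^sub>R (u_old + u_new) = u_half"
    by (simp add: assms(10) scaleR_fun_def fun_eq_iff)
  finally have half_in: "u_half \<in> X1d" .
  let ?p = "weak_deriv L u_new" and ?r = "weak_deriv L u_old" and ?s = "weak_deriv L u_half"
  have p: "has_L1_deriv L u_new ?p" "integrable lborel (cutoff L (\<lambda>x. (?p x)\<^sup>2))"
    and r: "has_L1_deriv L u_old ?r" "integrable lborel (cutoff L (\<lambda>x. (?r x)\<^sup>2))"
    and q: "has_L1_deriv L q_half (weak_deriv L q_half)"
    using H1 L by (auto intro: H1_weak_deriv)
  have half: "has_L1_deriv L u_half (\<lambda>x. 1 / 2 * (?r x + ?p x))"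
    unfolding assms(10) by (intro has_L1_deriv_cmult has_L1_deriv_add p r)
  note s = has_L1_deriv_weak_deriv[OF half L]
  have "bracket L (\<lambda>x. q_half x * ?s x + weak_deriv L (\<lambda>y. q_half y * u_half y) x) u_half = 0"
    using L q s(2)
  proof (rule transport_integral_zero)
    show "u_half (-L) = 0" "q_half L = 0" using bdry by (simp_all add: assms(10))
    show "has_L1_deriv L (\<lambda>x. q_half x * u_half x) (weak_deriv L (\<lambda>y. q_half y * u_half y))"
      using has_L1_deriv_weak_deriv(2)[OF has_L1_deriv_mult[OF q s(2)] L] .
  qed
  with assms(11)[OF half_in] have zero: "bracket L (\<lambda>x. (?p x - ?r x) / dt) ?s = 0" by simp
  \<comment> \<open>The same bracket is the energy difference, as \<open>?s\<close> is almost everywhere the mean of \<open>?p\<close> and \<open>?r\<close>.\<close>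
  have "bracket L (\<lambda>x. (?p x - ?r x) / dt) ?s
      = (LINT x|lborel. (cutoff L ?p x - cutoff L ?r x) / dt * cutoff L ?s x)"
    unfolding bracket_def set_lebesgue_integral_def
    by (intro Bochner_Integration.integral_cong) (auto simp: cutoff_def indicator_def)
  also have "\<dots> = (LINT x|lborel. (cutoff L (\<lambda>x. (?p x)\<^sup>2) x - cutoff L (\<lambda>x. (?r x)\<^sup>2) x) / (2 * dt))"
  proof (rule integral_cong_AE)
    show "AE x in lborel. (cutoff L ?p x - cutoff L ?r x) / dt * cutoff L ?s x
        = (cutoff L (\<lambda>x. (?p x)\<^sup>2) x - cutoff L (\<lambda>x. (?r x)\<^sup>2) x) / (2 * dt)"
      using s(1)
    proof eventually_elim
      case (elim x)
      show ?case
      proof (cases "x \<in> {-L<..<L}")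
        case True
        then have "?s x = 1 / 2 * (?r x + ?p x)" using elim by (simp add: cutoff_def)
        then have "(?p x - ?r x) / dt * ?s x = ((?p x)\<^sup>2 - (?r x)\<^sup>2) / (2 * dt)"
          using \<open>dt > 0\<close> by (simp only:) (simp add: power2_eq_square field_simps)
        with True show ?thesis by (simp add: cutoff_def)
      qed (simp add: cutoff_def)
    qed
    show "(\<lambda>x. (cutoff L ?p x - cutoff L ?r x) / dt * cutoff L ?s x) \<in> borel_measurable lborel"
      using p(1) r(1) s(2) by (auto dest!: has_L1_deriv_integrable borel_measurable_integrable)
    show "(\<lambda>x. (cutoff L (\<lambda>x. (?p x)\<^sup>2) x - cutoff L (\<lambda>x. (?r x)\<^sup>2) x) / (2 * dt)) \<in> borel_measurable lborel"
      using p(2) r(2) by (auto dest!: borel_measurable_integrable)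
  qed
  also have "\<dots> = ((LINT x|lborel. cutoff L (\<lambda>x. (?p x)\<^sup>2) x) - (LINT x|lborel. cutoff L (\<lambda>x. (?r x)\<^sup>2) x)) / (2 * dt)"
    using p(2) r(2) by simp
  finally show ?thesis
    using zero \<open>dt > 0\<close> by (simp add: set_integral_eq_cutoff)
qed

end
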